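(* Let $p\in(0,1)$, let $f\in\mathcal{A}(p)$, and suppose that $f(z)/z$ is non-vanishing in $\mathbb{D}\setminus\{0\}$. If $\left|\left(\frac{z}{f(z)}\right)''\right|\le 2$ for all $z\in\mathbb{D}$, then $f$ is univalent in $\mathbb{D}$. This condition is sufficient but not necessary for univalence: for every $p\in(0,1)$ there exists $f\in\mathcal{A}(p)$ with $f(z)/z$ non-vanishing in $\mathbb{D}\setminus\{0\}$ such that $f$ is univalent in $\mathbb{D}$ but $\left|\left(\frac{z}{f(z)}\right)''\right|>2$ for some $z\in\mathbb{D}$.
   Context: $\mathbb{D}=\{z\in\mathbb{C}:|z|<1\}$. For $p\in(0,1)$, $\mathcal{A}(p)$ is the class of all functions $f$ that are holomorphic in $\mathbb{D}\setminus\{p\}$, have a simple pole at $z=p$ (with nonzero residue), and satisfy $f(0)=0$ and $f'(0)=1$. Univalent in $\mathbb{D}$ means one-to-one in $\mathbb{D}$ as a map into the Riemann sphere, with $f(p)=\infty$. The function $z/f(z)$ is understood with its removable singularities filled in (value $1$ at $z=0$ and $0$ at $z=p$), so under the non-vanishing hypothesis it is analytic in $\mathbb{D}$; primes denote derivatives with respect to $z$. *)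

theory Defs
  imports "HOL-Complex_Analysis.Complex_Analysis"
begin

abbreviation unit_disc :: "complex set" where
  "unit_disc \<equiv> ball 0 1"

text \<open>
  The value of \<open>f\<close> at \<open>p\<close> itself is irrelevant: all notions below depend only on the values of
  \<open>f\<close> in the punctured disc. The residue at a pole of order one is automatically nonzero.
\<close>

definition class_A :: "real \<Rightarrow> (complex \<Rightarrow> complex) set" where
  "class_A p = {f. f holomorphic_on (unit_disc - {of_real p}) \<and>
                   is_pole f (of_real p) \<and> zorder f (of_real p) = -1 \<and>
                   f 0 = 0 \<and> deriv f 0 = 1}"

text \<open>
  The Riemann sphere is \<open>complex option\<close> with \<open>None\<close> as the point at infinity, the same
  convention as in \<^const>\<open>Alexandroff_compactification\<close>.
\<close>

definition sphere_map :: "real \<Rightarrow> (complex \<Rightarrow> complex) \<Rightarrow> complex \<Rightarrow> complex option" where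
  "sphere_map p f z = (if z = of_real p then None else Some (f z))"

definition univalent_in_disc :: "real \<Rightarrow> (complex \<Rightarrow> complex) \<Rightarrow> bool" where
  "univalent_in_disc p f \<longleftrightarrow> inj_on (sphere_map p f) unit_disc"

text \<open>At \<open>p\<close> the quotient \<open>f z / z\<close> is infinite, hence does not vanish there.\<close>

definition quotient_nonvanishing :: "real \<Rightarrow> (complex \<Rightarrow> complex) \<Rightarrow> bool" where
  "quotient_nonvanishing p f \<longleftrightarrow> (\<forall>z \<in> unit_disc - {0, of_real p}. f z / z \<noteq> 0)"

text \<open>The function \<open>z / f z\<close> with its removable singularities at \<open>0\<close> and \<open>p\<close> filled in.\<close>

definition z_over :: "real \<Rightarrow> (complex \<Rightarrow> complex) \<Rightarrow> complex \<Rightarrow> complex" where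
  "z_over p f z = (if z = 0 then 1 else if z = of_real p then 0 else z / f z)"

lemma z_over_eq_remove_sings:
  assumes p: "0 < p" "p < 1" and f: "f \<in> class_A p" and nv: "quotient_nonvanishing p f"
    and z: "z \<in> unit_disc"
  shows "z_over p f z = remove_sings (\<lambda>w. w / f w) z"
proof -
  have hol: "f holomorphic_on (unit_disc - {of_real p})" and pole: "is_pole f (of_real p)"
    and f0: "f 0 = 0" and d0: "deriv f 0 = 1"
    using f by (auto simp: class_A_def)
  have op: "open (unit_disc - {complex_of_real p})" by (intro open_delete open_ball)
  consider "z = 0" | "z = of_real p" | "z \<noteq> 0" "z \<noteq> of_real p" by blast
  then show ?thesis
  proof cases
    case 1
    have "(f has_field_derivative 1) (at 0)"
      using holomorphic_derivI[OF hol op, of 0] p d0 by auto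
    then have "(\<lambda>w. f w / w) \<midarrow>0\<rightarrow> 1"
      by (simp add: has_field_derivative_iff f0)
    then have "(\<lambda>w. inverse (f w / w)) \<midarrow>0\<rightarrow> inverse 1"
      by (intro tendsto_inverse) auto
    then have "(\<lambda>w. w / f w) \<midarrow>0\<rightarrow> 1" by simp
    then show ?thesis using 1 by (simp add: z_over_def remove_sings_eqI)
  next
    case 2
    have "(\<lambda>w. inverse (f w)) \<midarrow>of_real p\<rightarrow> 0"
      using pole unfolding is_pole_def by (rule filterlim_compose[OF tendsto_inverse_0])
    then have "(\<lambda>w. w * inverse (f w)) \<midarrow>of_real p\<rightarrow> of_real p * 0"
      by (intro tendsto_mult tendsto_ident_at)
    then have "(\<lambda>w. w / f w) \<midarrow>of_real p\<rightarrow> 0" by (simp add: divide_inverse)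
    then show ?thesis using 2 p by (simp add: z_over_def remove_sings_eqI)
  next
    case 3
    have "f z \<noteq> 0" using nv z 3 by (auto simp: quotient_nonvanishing_def)
    moreover have "isCont f z"
      using hol op z 3 by (metis DiffI continuous_on_eq_continuous_at
          holomorphic_on_imp_continuous_on singletonD)
    ultimately have "isCont (\<lambda>w. w / f w) z" by (intro continuous_intros)
    then have "(\<lambda>w. w / f w) \<midarrow>z\<rightarrow> z / f z" by (simp add: isCont_def)
    then show ?thesis using 3 by (simp add: z_over_def remove_sings_eqI)
  qed
qed

end

theory Submission
  imports Defs
begin

text \<open>
  Put \<open>h z = z / f z = 1 + z * \<psi> z\<close>. For nonzero \<open>z\<close> and \<open>w\<close> the equation \<open>f z = f w\<close> reads
  \<open>1 / z - 1 / w = \<psi> w - \<psi> z\<close>, which is impossible for \<open>z \<noteq> w\<close> in the disc when \<open>\<psi>\<close> is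
  nonexpansive, since \<open>\<bar>z w\<bar> < 1\<close>. Now \<open>z\<^sup>2 \<psi>' z = z h' z - h z + 1\<close> has derivative \<open>z h'' z\<close>, so
  \<open>\<bar>h''\<bar> \<le> 2\<close> yields \<open>\<bar>\<psi>'\<bar> \<le> 1\<close>. The condition is not necessary because
  \<open>\<psi> z = c + z\<^sup>2 / 2\<close> is nonexpansive while \<open>h'' z = 3 z\<close>; the constant \<open>c\<close> is
  determined by \<open>h p = 0\<close>.
\<close>

lemma univalent_in_disc_if_nonexpansive:
  assumes f0: "f 0 = 0" and nv: "quotient_nonvanishing p f"
    and h: "\<And>z. z \<in> unit_disc \<Longrightarrow> z_over p f z = 1 + z * \<psi> z"
    and nonexp: "\<And>z w. z \<in> unit_disc \<Longrightarrow> w \<in> unit_disc \<Longrightarrow> norm (\<psi> z - \<psi> w) \<le> norm (z - w)"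
  shows "univalent_in_disc p f"
  unfolding univalent_in_disc_def
proof (rule inj_onI)
  fix z w
  assume z: "z \<in> unit_disc" and w: "w \<in> unit_disc"
    and eq: "sphere_map p f z = sphere_map p f w"
  have zero: "u = 0" if "f u = 0" "u \<in> unit_disc" "u \<noteq> of_real p" for u
    using nv that by (force simp: quotient_nonvanishing_def)
  show "z = w"
  \<comment> \<open>The equation for reciprocals needs \<open>z\<close> and \<open>w\<close> to be
    nonzero and \<open>f\<close> finite there. The excluded points match only themselves:
    \<open>None\<close> is attained only at \<open>p\<close>, and by \<open>zero\<close> the value 0
    only at 0.\<close>
  proof (cases "z = of_real p \<or> w = of_real p \<or> z = 0 \<or> w = 0")
    case True
    then show ?thesis
      using eq f0 zero[of z] zero[of w] z w by (auto simp: sphere_map_def split: if_splits)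
  next
    case False
    have few: "f z = f w" using eq False by (simp add: sphere_map_def)
    have "z / f z = 1 + z * \<psi> z" "w / f w = 1 + w * \<psi> w"
      using h[OF z] h[OF w] False by (auto simp: z_over_def)
    then have "w * (1 + z * \<psi> z) = z * (1 + w * \<psi> w)"
      using few by (metis mult.commute times_divide_eq_right)
    then have "z - w = z * w * (\<psi> z - \<psi> w)" by (simp add: algebra_simps)
    then have "norm (z - w) = norm (z * w) * norm (\<psi> z - \<psi> w)" by (metis norm_mult)
    also have "\<dots> \<le> norm (z * w) * norm (z - w)"
      by (intro mult_left_mono nonexp z w) auto
    finally have le: "norm (z - w) \<le> norm (z * w) * norm (z - w)" .
    have "norm z * norm w < 1 * 1"
      using z w by (intro mult_strict_mono) auto
    then have "norm (z * w) < 1" by (simp add: norm_mult)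
    then show ?thesis
      using le by (metis eq_iff_diff_eq_0 mult_less_cancel_right2 norm_ge_zero norm_eq_zero
          linorder_not_le order_le_less)
  qed
qed

text \<open>Riemann's theorem removes both singularities: \<open>f w / w\<close> tends to
  \<open>deriv f 0 = 1\<close> at 0, and \<open>1 / f w\<close> tends to 0 at the pole. Elsewhere in
  the disc \<open>f\<close> has no zeros.\<close>

lemma z_over_holomorphic:
  assumes p: "0 < p" "p < 1" and f: "f \<in> class_A p" and nv: "quotient_nonvanishing p f"
  shows "z_over p f holomorphic_on unit_disc"
proof -
  have hol: "f holomorphic_on (unit_disc - {of_real p})" and pole: "is_pole f (of_real p)"
    and f0: "f 0 = 0" and d0: "deriv f 0 = 1"
    using f by (auto simp: class_A_def)
  have op: "open (unit_disc - {complex_of_real p})" by (intro open_delete open_ball)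
  have tends: "(\<lambda>w. w / f w) \<midarrow>z\<rightarrow> z_over p f z" if "z \<in> {0, of_real p}" for z
  proof (cases "z = 0")
    case True
    have "(f has_field_derivative 1) (at 0)"
      using holomorphic_derivI[OF hol op, of 0] p d0 by auto
    then have "(\<lambda>w. f w / w) \<midarrow>0\<rightarrow> 1"
      by (simp add: has_field_derivative_iff f0)
    then have "(\<lambda>w. inverse (f w / w)) \<midarrow>0\<rightarrow> inverse 1"
      by (intro tendsto_inverse) auto
    then show ?thesis using True by (simp add: z_over_def)
  next
    case False
    have "(\<lambda>w. inverse (f w)) \<midarrow>of_real p\<rightarrow> 0"
      using pole unfolding is_pole_def by (rule filterlim_compose[OF tendsto_inverse_0])
    then have "(\<lambda>w. w * inverse (f w)) \<midarrow>of_real p\<rightarrow> of_real p * 0"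
      by (intro tendsto_mult tendsto_ident_at)
    then show ?thesis using False that by (simp add: z_over_def divide_inverse)
  qed
  show ?thesis
  proof (rule no_isolated_singularity'[where K = "{0, of_real p}"])
    show "z_over p f holomorphic_on unit_disc - {0, of_real p}"
    proof (rule holomorphic_transform)
      show "(\<lambda>z. z / f z) holomorphic_on unit_disc - {0, of_real p}"
        using nv by (intro holomorphic_intros holomorphic_on_subset[OF hol])
          (auto simp: quotient_nonvanishing_def)
    qed (auto simp: z_over_def)
    show "(z_over p f \<longlongrightarrow> z_over p f z) (at z within unit_disc)" if z: "z \<in> {0, of_real p}" for z
    proof -
      \<comment> \<open>Near \<open>z\<close> the other exceptional point is avoided, so
        \<open>z_over p f\<close> is the plain quotient there.\<close>
      have "\<forall>\<^sub>F w in at z. w \<in> - ({0, of_real p} - {z})"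
        by (intro eventually_at_in_open' open_Compl finite_imp_closed) auto
      then have "\<forall>\<^sub>F w in at z. w / f w = z_over p f w"
        using eventually_neq_at_within[of z z UNIV]
        by eventually_elim (auto simp: z_over_def)
      then have "z_over p f \<midarrow>z\<rightarrow> z_over p f z"
        using tends[OF z] by (blast intro: Lim_transform_eventually)
      then show ?thesis by (rule tendsto_within_subset) auto
    qed
  qed auto
qed

text \<open>Along the radius \<open>t * z\<close> the speed is at most
  \<open>2 * t * (norm z)\<^sup>2\<close>, which integrates over \<open>{0..1}\<close> to
  \<open>(norm z)\<^sup>2\<close>. A mean value estimate with the largest speed would lose a factor
  2.\<close>

lemma norm_le_square_if_deriv_le:
  fixes F F' :: "complex \<Rightarrow> complex"
  assumes F: "\<And>z. z \<in> unit_disc \<Longrightarrow> (F has_field_derivative F' z) (at z)"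
    and F0: "F 0 = 0" and F': "\<And>z. z \<in> unit_disc \<Longrightarrow> norm (F' z) \<le> 2 * norm z"
    and z: "z \<in> unit_disc"
  shows "norm (F z) \<le> (norm z)\<^sup>2"
proof -
  have inD: "of_real t * z \<in> unit_disc" if "0 \<le> t" "t \<le> 1" for t
    using z that mult_left_le_one_le[of "norm z" t] by (auto simp: norm_mult)
  have vd: "((\<lambda>t. F (of_real t * z)) has_vector_derivative F' (of_real t * z) * z) (at t)"
    if "0 \<le> t" "t \<le> 1" for t
  proof -
    have "((\<lambda>u. F (u * z)) has_field_derivative F' (of_real t * z) * z) (at (of_real t))"
      by (rule DERIV_chain2[where f = F and g = "\<lambda>u. u * z", OF F[OF inD[OF that]]])
        (auto intro!: derivative_eq_intros)
    then show ?thesis by (rule has_vector_derivative_real_field)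
  qed
  have "norm (F (of_real 1 * z) - F (of_real 0 * z)) \<le> (norm z)\<^sup>2 * 1\<^sup>2 - (norm z)\<^sup>2 * 0\<^sup>2"
  proof (rule differentiable_bound_general[where f' = "\<lambda>t. F' (of_real t * z) * z"
          and \<phi> = "\<lambda>t. (norm z)\<^sup>2 * t\<^sup>2" and \<phi>' = "\<lambda>t. 2 * t * (norm z)\<^sup>2"])
    show "continuous_on {0..1} (\<lambda>t. F (of_real t * z))"
      using vd by (intro continuous_at_imp_continuous_on ballI)
        (rule has_vector_derivative_continuous, rule vd, auto)
    show "norm (F' (of_real t * z) * z) \<le> 2 * t * (norm z)\<^sup>2" if "0 < t" "t < 1" for t :: real
      using mult_right_mono[OF F'[OF inD[of t]], of "norm z"] that
      by (simp add: norm_mult power2_eq_square mult_ac)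
    show "continuous_on {0..1} (\<lambda>t. (norm z)\<^sup>2 * t\<^sup>2)" by (intro continuous_intros)
  qed (use vd in \<open>auto intro!: derivative_eq_intros
        simp flip: has_real_derivative_iff_has_vector_derivative\<close>)
  then show ?thesis by (simp add: F0)
qed

lemma univalent_in_disc_if_second_deriv_le:
  assumes p: "0 < p" "p < 1" and f: "f \<in> class_A p" and nv: "quotient_nonvanishing p f"
    and le: "\<And>z. z \<in> unit_disc \<Longrightarrow> norm ((deriv ^^ 2) (z_over p f) z) \<le> 2"
  shows "univalent_in_disc p f"
proof -
  define h where "h = z_over p f"
  \<comment> \<open>The difference quotient of \<open>h\<close> at 0, in the shape for which
    \<open>pole_lemma\<close> gives holomorphy across 0.\<close>
  define \<psi> where "\<psi> z = (if z = 0 then deriv h 0 else (h z - h 0) / (z - 0))" for z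
  have h0: "h 0 = 1" by (simp add: h_def z_over_def)
  have hol: "h holomorphic_on unit_disc"
    unfolding h_def by (rule z_over_holomorphic[OF p f nv])
  have dh: "(h has_field_derivative deriv h z) (at z)" if "z \<in> unit_disc" for z
    using holomorphic_derivI[OF hol open_ball that] .
  have ddh: "(deriv h has_field_derivative (deriv ^^ 2) h z) (at z)" if "z \<in> unit_disc" for z
    using holomorphic_derivI[OF holomorphic_deriv[OF hol open_ball] open_ball that]
    by (simp add: numeral_2_eq_2)
  have \<psi>_hol: "\<psi> holomorphic_on unit_disc"
    unfolding \<psi>_def by (rule pole_lemma[OF hol]) auto
  have W: "norm (z * deriv h z - h z + 1) \<le> (norm z)\<^sup>2" if "z \<in> unit_disc" for z
  proof (rule norm_le_square_if_deriv_le[where F = "\<lambda>z. z * deriv h z - h z + 1"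
        and F' = "\<lambda>z. z * (deriv ^^ 2) h z", OF _ _ _ that])
    show "((\<lambda>z. z * deriv h z - h z + 1) has_field_derivative z * (deriv ^^ 2) h z) (at z)"
      if "z \<in> unit_disc" for z
      by (rule derivative_eq_intros dh[OF that] ddh[OF that] refl)+ (simp add: algebra_simps)
    show "norm (z * (deriv ^^ 2) h z) \<le> 2 * norm z" if "z \<in> unit_disc" for z
      using mult_left_mono[OF le[OF that], of "norm z"] by (simp add: norm_mult h_def mult_ac)
  qed (simp add: h0)
  have ne: "norm (deriv \<psi> z) \<le> 1" if z: "z \<in> unit_disc - {0}" for z
  proof -
    have "((\<lambda>z. (h z - 1) / z) has_field_derivative (deriv h z * z - (h z - 1)) / (z * z)) (at z)"
      using z by (auto intro!: derivative_eq_intros dh)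
    then have "(\<psi> has_field_derivative (deriv h z * z - (h z - 1)) / (z * z)) (at z)"
      by (rule has_field_derivative_transform_within_open[of _ _ _ "- {0}"])
        (use z in \<open>auto simp: \<psi>_def h0 open_delete\<close>)
    then have "deriv \<psi> z = (z * deriv h z - h z + 1) / (z * z)"
      by (simp add: DERIV_imp_deriv algebra_simps)
    then show ?thesis
      using W[of z] z by (simp add: norm_divide norm_mult power2_eq_square divide_le_eq)
  qed
  \<comment> \<open>The quotient rule says nothing at 0; there the bound is the limit of the bounds
    nearby, because \<open>deriv \<psi>\<close> is continuous.\<close>
  have d\<psi>: "norm (deriv \<psi> z) \<le> 1" if z: "z \<in> unit_disc" for z
  proof (cases "z = 0")
    case True
    have "isCont (deriv \<psi>) 0"
      using holomorphic_deriv[OF \<psi>_hol open_ball]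
      by (auto simp: continuous_on_eq_continuous_at dest!: holomorphic_on_imp_continuous_on)
    then have lim: "((\<lambda>w. norm (deriv \<psi> w)) \<longlongrightarrow> norm (deriv \<psi> 0)) (at 0)"
      by (intro tendsto_norm) (simp add: isCont_def)
    have "\<forall>\<^sub>F w in at (0::complex). w \<in> unit_disc - {0}"
      by (rule eventually_at_in_open) auto
    then have "\<forall>\<^sub>F w in at 0. norm (deriv \<psi> w) \<le> 1"
      by (rule eventually_mono) (rule ne)
    then show ?thesis using tendsto_upperbound[OF lim] True by simp
  qed (use ne z in auto)
  show ?thesis
  proof (rule univalent_in_disc_if_nonexpansive[OF _ nv])
    show "f 0 = 0" using f by (simp add: class_A_def)
    show "z_over p f z = 1 + z * \<psi> z" for z
      using h0 by (auto simp: \<psi>_def h_def)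
    \<comment> \<open>The disc is convex, so the derivative bound 1 is a Lipschitz constant.\<close>
    show "norm (\<psi> z - \<psi> w) \<le> norm (z - w)" if "z \<in> unit_disc" "w \<in> unit_disc" for z w
      using field_differentiable_bound[of unit_disc \<psi> "deriv \<psi>" 1 z w] that d\<psi>
        holomorphic_derivI[OF \<psi>_hol open_ball] by auto
  qed
qed

lemma univalent_with_large_second_deriv:
  fixes p :: real
  assumes p: "0 < p" "p < 1"
  shows "\<exists>f \<in> class_A p. quotient_nonvanishing p f \<and> univalent_in_disc p f \<and>
           (\<exists>z \<in> unit_disc. norm ((deriv ^^ 2) (z_over p f) z) > 2)"
proof -
  define P where "P = complex_of_real p"
  \<comment> \<open>The cofactor of \<open>z - P\<close> in the cubic
    \<open>1 + z * \<psi> z\<close>, which vanishes at \<open>P\<close> by the choice of the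
    constant in \<open>\<psi>\<close>.\<close>
  define q where "q z = (z\<^sup>2 + P * z) / 2 - 1 / P" for z
  define f where "f z = z / ((z - P) * q z)" for z
  define \<psi> where "\<psi> z = z\<^sup>2 / 2 - P\<^sup>2 / 2 - 1 / P" for z
  have P: "P \<noteq> 0" "P \<in> unit_disc" "norm P < 1" using p by (auto simp: P_def)
  \<comment> \<open>At a root \<open>z\<^sup>2 + P * z = 2 / P\<close>, but in the disc the left
    side has modulus at most 2 and the right side exceeds 2. Hence \<open>P\<close> is the only pole
    of \<open>f\<close> in the disc.\<close>
  have q_nz: "q z \<noteq> 0" if z: "z \<in> unit_disc" for z
  proof
    assume "q z = 0"
    then have "z * z + P * z = 2 / P" by (simp add: q_def power2_eq_square)
    then have "2 / norm P = norm (z * z + P * z)" by (simp add: norm_divide)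
    also have "\<dots> \<le> norm z * norm z + norm P * norm z"
      by (metis norm_mult norm_triangle_ineq)
    also have "\<dots> \<le> 1 * 1 + 1 * 1"
      using z P by (intro add_mono mult_mono) auto
    finally show False using P by (simp add: divide_le_eq)
  qed
  have fact: "(z - P) * q z = 1 + z * \<psi> z" for z
    using P by (simp add: q_def \<psi>_def field_simps power2_eq_square)
  \<comment> \<open>This holds for every complex \<open>z\<close>: the filled-in values agree with
    the cubic, and at a root of \<open>q\<close> division by zero yields 0 on the left as
    well.\<close>
  have h: "z_over p f z = 1 + z * \<psi> z" for z
    using fact[of z] by (auto simp: z_over_def f_def simp flip: P_def)
  have q_hol: "q holomorphic_on A" for A
    unfolding q_def by (intro holomorphic_intros) (use P in auto)
  have nv: "quotient_nonvanishing p f"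
    using q_nz by (auto simp: quotient_nonvanishing_def f_def simp flip: P_def)
  have f0: "f 0 = 0" by (simp add: f_def)
  have f_hol: "f holomorphic_on unit_disc - {P}"
    unfolding f_def using q_nz by (intro holomorphic_intros q_hol) auto
  \<comment> \<open>Here \<open>f z\<close> is \<open>z / q z\<close> times the inverse of
    \<open>z - P\<close>, and the first factor is holomorphic in the disc and nonzero at
    \<open>P\<close>.\<close>
  have zq: "zorder f P = -1"
  proof (rule zorder_eqI[where S = unit_disc and g = "\<lambda>z. z / q z"])
    show "(\<lambda>z. z / q z) holomorphic_on unit_disc"
      using q_nz by (intro holomorphic_intros q_hol) auto
  qed (use P q_nz in \<open>auto simp: f_def power_int_minus divide_simps\<close>)
  have pole: "is_pole f P"
  proof -
    have "isCont (\<lambda>z. z / q z) P"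
      unfolding q_def using q_nz[OF P(2)] P(1) by (intro continuous_intros) (auto simp: q_def)
    moreover have "filterlim (\<lambda>z. z - P) (at 0) (at P)"
      by (auto simp: filterlim_at eventually_at_filter intro: LIM_zero)
    ultimately have "is_pole (\<lambda>z. (z / q z) / (z - P)) P"
      using is_pole_divide[of P "\<lambda>z. z / q z" "\<lambda>z. z - P"] q_nz[OF P(2)] P(1) by simp
    then show ?thesis by (simp add: f_def[abs_def] divide_simps mult_ac)
  qed
  have "(f has_field_derivative 1) (at 0)"
    unfolding f_def fact \<psi>_def
    by (rule derivative_eq_intros refl | simp)+
  then have "deriv f 0 = 1" by (rule DERIV_imp_deriv)
  then have "f \<in> class_A p"
    using f_hol pole zq f0 by (simp add: class_A_def P_def)
  moreover have "univalent_in_disc p f"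
  proof (rule univalent_in_disc_if_nonexpansive[OF f0 nv h])
    show "norm (\<psi> z - \<psi> w) \<le> norm (z - w)" if "z \<in> unit_disc" "w \<in> unit_disc" for z w
    proof -
      \<comment> \<open>The constant cancels, and the midpoint of \<open>z\<close> and
        \<open>w\<close> has modulus at most 1.\<close>
      have "\<psi> z - \<psi> w = (z + w) / 2 * (z - w)"
        by (simp add: \<psi>_def field_simps power2_eq_square)
      moreover have "norm ((z + w) / 2) \<le> 1"
        using that norm_triangle_ineq[of z w] by (simp add: norm_divide)
      ultimately show ?thesis
        by (metis norm_mult mult_left_le_one_le norm_ge_zero)
    qed
  qed
  \<comment> \<open>The second derivative \<open>3 * z\<close> exceeds 2 in modulus once
    \<open>norm z > 2/3\<close>, so the point 3/4 serves for every \<open>p\<close>.\<close>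
  moreover have "norm ((deriv ^^ 2) (z_over p f) (3/4)) > 2"
  proof -
    have "deriv (z_over p f) = (\<lambda>z. \<psi> z + z * z)"
      unfolding h[abs_def] \<psi>_def
      by (intro ext DERIV_imp_deriv) (auto intro!: derivative_eq_intros simp: power2_eq_square)
    moreover have "deriv (\<lambda>z. \<psi> z + z * z) z = 3 * z" for z
      unfolding \<psi>_def by (intro DERIV_imp_deriv) (auto intro!: derivative_eq_intros)
    ultimately have "(deriv ^^ 2) (z_over p f) (3/4) = 9/4" by (simp add: numeral_2_eq_2)
    then show ?thesis by (simp only: norm_divide norm_numeral)
  qed
  moreover have "3/4 \<in> unit_disc" by simp
  ultimately show ?thesis using nv by blast
qed

theorem theorem2:
  fixes p :: real
  assumes "0 < p" and "p < 1"
  shows "(\<forall>f \<in> class_A p. quotient_nonvanishing p f \<longrightarrow>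
            (\<forall>z \<in> unit_disc. norm ((deriv ^^ 2) (z_over p f) z) \<le> 2) \<longrightarrow>
            univalent_in_disc p f)
       \<and> (\<exists>f \<in> class_A p. quotient_nonvanishing p f \<and> univalent_in_disc p f \<and>
            (\<exists>z \<in> unit_disc. norm ((deriv ^^ 2) (z_over p f) z) > 2))"
  using univalent_in_disc_if_second_deriv_le[OF assms] univalent_with_large_second_deriv[OF assms]
  by blast

end
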